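(* Let $N\ge 1$, $\beta\in(0,1)$, let $t:\mathbb{N}\to[0,1]$ be the function associated with $N$ and $\beta$ defined in the context, and set $\varepsilon(k)\doteq1-t(k)$. Let $F:\mathbb{R}^n\to\mathbb{R}^n$, let $(\Delta,\mathcal{F},\mathbb{P})$ be a probability space, let $\{\mathcal{X}_\delta\}_{\delta\in\Delta}$ be a family of set-valued maps $\mathcal{X}_\delta:\mathbb{R}^n\rightrightarrows\mathbb{R}^n$, and let $\delta_1,\dots,\delta_N$ be independent samples from $(\Delta,\mathcal{F},\mathbb{P})$. Assume Existence-and-uniqueness and Non-degeneracy (as stated in the context). Let $x^\star$ be the unique solution of the quasi variational inequality: $x^\star\in\mathcal{X}(x^\star)\doteq\bigcap_{i=1}^N\mathcal{X}_{\delta_i}(x^\star)$ and $F(x^\star)^\top(x-x^\star)\ge0$ for all $x\in\mathcal{X}(x^\star)$; let $s^\star$ be its number of support constraints and $V$ the risk. Then, for any $\Delta$ and $\mathbb{P}$, $$\mathbb{P}^N[V(x^\star)\le\varepsilon(s^\star)]\ge1-\beta .$$ If, in addition, the sets $\{\mathcal{X}_{\delta_i}(x^\star)\}_{i=1}^N$ are convex (for every tuple of samples), then $s^\star\le n$ and $$\mathbb{P}^N[V(x^\star)\le\varepsilon(n)]\ge1-\beta .$$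
   Context: Quasi variational inequality (QVI): for samples $(\delta_1,\dots,\delta_N)$, find $x^\star\in\mathcal{X}(x^\star)\doteq\bigcap_{i=1}^N\mathcal{X}_{\delta_i}(x^\star)$ such that $F(x^\star)^\top(x-x^\star)\ge0$ for all $x\in\mathcal{X}(x^\star)$. If no constraint is present, $\mathcal{X}(x)=\mathbb{R}^n$ for all $x$. Existence-and-uniqueness: for any number $N\ge1$ of samples and any tuple $(\delta_1,\dots,\delta_N)\in\Delta^N$, the QVI admits a unique solution, denoted $x^\star$. Risk: $V(x)\doteq\mathbb{P}\{\delta\in\Delta : x\notin\mathcal{X}_\delta(x)\}$. Support constraint: the constraint defined by $\mathcal{X}_{\delta_i}$ is of support if its removal (i.e. replacing $\mathcal{X}(\cdot)$ by $\bigcap_{l\neq i}\mathcal{X}_{\delta_l}(\cdot)$) modifies the solution $x^\star$. $s^\star$ is the number of support constraints. Non-degeneracy: $\mathbb{P}^N$-almost surely, $x^\star$ coincides with the (unique) solution of the QVI obtained by eliminating all the constraints that are not of support. The function $t$: for $k\in\{0,\dots,N-1\}$, $t(k)$ is the unique solution in $(0,1)$ of the polynomial equation in $t$ $$\frac{\beta}{N+1}\sum_{l=k}^{N}\binom{l}{k}t^{l-k}-\binom{N}{k}t^{N-k}=0,$$ (existence and uniqueness of this root is a known fact), and $t(k)=0$ for $k\ge N$. All quantities involved are assumed measurable. $\mathbb{P}^N$ is the $N$-fold product measure. *)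

theory Defs
  imports "HOL-Probability.Probability"
begin

text \<open>The constraints in force are those of the scenarios \<open>\<delta> i\<close> with \<open>i \<in> I\<close>.
  For \<open>I = {}\<close> the intersection is the whole space, i.e. no constraint is present.\<close>

definition qvi_feasible ::
    "('d \<Rightarrow> real ^ 'n \<Rightarrow> (real ^ 'n) set) \<Rightarrow> nat set \<Rightarrow> (nat \<Rightarrow> 'd) \<Rightarrow> real ^ 'n \<Rightarrow> (real ^ 'n) set" where
  "qvi_feasible X I \<delta> x = (\<Inter>i\<in>I. X (\<delta> i) x)"

definition qvi_solution ::
    "(real ^ 'n \<Rightarrow> real ^ 'n) \<Rightarrow> ('d \<Rightarrow> real ^ 'n \<Rightarrow> (real ^ 'n) set) \<Rightarrow> nat set \<Rightarrow> (nat \<Rightarrow> 'd)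
      \<Rightarrow> real ^ 'n \<Rightarrow> bool" where
  "qvi_solution F X I \<delta> x \<longleftrightarrow>
     x \<in> qvi_feasible X I \<delta> x \<and> (\<forall>y \<in> qvi_feasible X I \<delta> x. F x \<bullet> (y - x) \<ge> 0)"

definition qvi_unique_solution ::
    "(real ^ 'n \<Rightarrow> real ^ 'n) \<Rightarrow> ('d \<Rightarrow> real ^ 'n \<Rightarrow> (real ^ 'n) set) \<Rightarrow> nat set \<Rightarrow> (nat \<Rightarrow> 'd)
      \<Rightarrow> real ^ 'n \<Rightarrow> bool" where
  "qvi_unique_solution F X I \<delta> x \<longleftrightarrow>
     qvi_solution F X I \<delta> x \<and> (\<forall>y. qvi_solution F X I \<delta> y \<longrightarrow> y = x)"

text \<open>Only meaningful when the solution exists and is unique.\<close>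

definition qvi_sol ::
    "(real ^ 'n \<Rightarrow> real ^ 'n) \<Rightarrow> ('d \<Rightarrow> real ^ 'n \<Rightarrow> (real ^ 'n) set) \<Rightarrow> nat set \<Rightarrow> (nat \<Rightarrow> 'd)
      \<Rightarrow> real ^ 'n" where
  "qvi_sol F X I \<delta> = (THE x. qvi_solution F X I \<delta> x)"

text \<open>Removing constraint \<open>i\<close> leaves the solution unchanged iff the old solution is the unique
  solution of the reduced problem. If \<open>I = {i}\<close>, the reduced problem is unconstrained and need not
  have exactly one solution; in that case \<open>i\<close> counts as a support constraint.\<close>

definition support_constraints ::
    "(real ^ 'n \<Rightarrow> real ^ 'n) \<Rightarrow> ('d \<Rightarrow> real ^ 'n \<Rightarrow> (real ^ 'n) set) \<Rightarrow> nat set \<Rightarrow> (nat \<Rightarrow> 'd)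
      \<Rightarrow> nat set" where
  "support_constraints F X I \<delta> =
     {i \<in> I. \<not> qvi_unique_solution F X (I - {i}) \<delta> (qvi_sol F X I \<delta>)}"

definition risk ::
    "'d measure \<Rightarrow> ('d \<Rightarrow> real ^ 'n \<Rightarrow> (real ^ 'n) set) \<Rightarrow> real ^ 'n \<Rightarrow> real" where
  "risk P X x = measure P {d \<in> space P. x \<notin> X d x}"

definition t_fun :: "nat \<Rightarrow> real \<Rightarrow> nat \<Rightarrow> real" where
  "t_fun N \<beta> k =
     (if k < N then
        (THE t. 0 < t \<and> t < 1 \<and>
           \<beta> / (real N + 1) * (\<Sum>l=k..N. real (l choose k) * t ^ (l - k))
             - real (N choose k) * t ^ (N - k) = 0)
      else 0)"

definition eps_fun :: "nat \<Rightarrow> real \<Rightarrow> nat \<Rightarrow> real" where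
  "eps_fun N \<beta> k = 1 - t_fun N \<beta> k"

end

theory Submission
  imports Defs
begin

text \<open>For \<open>J \<subseteq> K\<close> let \<open>J\<close> \<^emph>\<open>generate\<close> \<open>K\<close> when every constraint of \<open>J\<close> is of support in the problem
  with constraints \<open>J\<close>, and the solution \<open>x\<^sub>J\<close> of that problem satisfies the constraints \<open>K - J\<close>. Given
  the samples in \<open>J\<close>, the latter has probability \<open>(1 - V x\<^sub>J) ^ \<bar>K - J\<bar>\<close>. Non-degeneracy makes these events
  almost surely disjoint for fixed \<open>K\<close>, so their probabilities sum to at most 1 for each of the \<open>2 ^ N\<close>
  sets \<open>K\<close>. Weighting these inequalities by \<open>\<beta> / ((N + 1) (N choose \<bar>K\<bar>))\<close>, which adds up to \<open>\<beta>\<close>, yields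
  the polynomial defining \<open>t\<close> as an upper bound of \<open>(1 - V x\<^sub>J) ^ (N - \<bar>J\<bar>)\<close> wherever
  \<open>V x\<^sub>J > \<epsilon> \<bar>J\<bar>\<close>; with \<open>J\<close> the support set of the full problem this bounds the probability of a large risk.
  In the convex case Helly's theorem bounds the number of support constraints.\<close>

subsection \<open>The function t\<close>

text \<open>Divided by \<open>(N choose k) * t ^ (N - k)\<close>, the equation defining \<open>t\<close> becomes monotone in \<open>t\<close> and in \<open>k\<close>.\<close>

definition scaled_poly :: "nat \<Rightarrow> nat \<Rightarrow> real \<Rightarrow> real" where
  "scaled_poly N k t = (\<Sum>l=k..N. real (l choose k) / real (N choose k) * inverse t ^ (N - l))"

lemma scaled_poly_eq:
  assumes "k \<le> N" "0 < t"
  shows "(\<Sum>l=k..N. real (l choose k) * t ^ (l - k)) = real (N choose k) * t ^ (N - k) * scaled_poly N k t"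
proof -
  have "t ^ (l - k) = t ^ (N - k) * inverse t ^ (N - l)" if "l \<in> {k..N}" for l
  proof -
    have "N - k = (l - k) + (N - l)" using that by auto
    then have "t ^ (N - k) = t ^ (l - k) * t ^ (N - l)" by (simp only: power_add)
    then show ?thesis using assms by (simp add: power_inverse field_simps)
  qed
  then have "(\<Sum>l=k..N. real (l choose k) * t ^ (l - k))
      = (\<Sum>l=k..N. real (l choose k) * (t ^ (N - k) * inverse t ^ (N - l)))"
    by (intro sum.cong refl arg_cong2[where f = "(*)"])
  also have "\<dots> = real (N choose k) * t ^ (N - k) * scaled_poly N k t"
    unfolding scaled_poly_def sum_distrib_left using assms by (intro sum.cong) (auto simp: binomial_eq_0_iff)
  finally show ?thesis .
qed

lemma scaled_poly_strict_antimono: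
  assumes "k < N" "0 < s" "s < t"
  shows "scaled_poly N k t < scaled_poly N k s"
  unfolding scaled_poly_def
proof (rule sum_strict_mono_ex1)
  have inv: "0 < inverse t" "inverse t < inverse s" using assms by auto
  show "\<forall>l\<in>{k..N}. real (l choose k) / real (N choose k) * inverse t ^ (N - l)
      \<le> real (l choose k) / real (N choose k) * inverse s ^ (N - l)"
    using inv by (intro ballI mult_left_mono power_mono) auto
  \<comment> \<open>Strictness comes from the term \<open>l = k\<close>, whose exponent
    \<open>N - k\<close> is positive.\<close>
  have "inverse t ^ (N - k) < inverse s ^ (N - k)"
    using inv assms by (intro power_strict_mono) auto
  then show "\<exists>l\<in>{k..N}. real (l choose k) / real (N choose k) * inverse t ^ (N - l)
      < real (l choose k) / real (N choose k) * inverse s ^ (N - l)"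
    using assms by (intro bexI[of _ k] mult_strict_left_mono) auto
qed simp

text \<open>Passing from \<open>k\<close> to \<open>Suc k\<close> multiplies the coefficient of
  index \<open>l\<close> by \<open>(l - k) / (N - k) \<le> 1\<close> and drops the nonnegative term
  \<open>l = k\<close>.\<close>

lemma scaled_poly_Suc_le:
  assumes "Suc k \<le> N" "0 < t"
  shows "scaled_poly N (Suc k) t \<le> scaled_poly N k t"
proof -
  have coeff: "real (l choose Suc k) / real (N choose Suc k) \<le> real (l choose k) / real (N choose k)"
    if l: "l \<in> {Suc k..N}" for l
  proof -
    \<comment> \<open>Used for \<open>m = l\<close> in the numerator and \<open>m = N\<close> in the
      denominator.\<close>
    have absorb: "real (Suc k) * real (m choose Suc k) = real (m - k) * real (m choose k)" for m
      using binomial_absorb_comp[of m k] binomial_absorption[of k m] by (simp only: flip: of_nat_mult)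
    have "real (l choose Suc k) / real (N choose Suc k)
        = (real (Suc k) * real (l choose Suc k)) / (real (Suc k) * real (N choose Suc k))"
      by simp
    also have "\<dots> = (real (l - k) / real (N - k)) * (real (l choose k) / real (N choose k))"
      unfolding absorb by simp
    also have "\<dots> \<le> 1 * (real (l choose k) / real (N choose k))"
      using l by (intro mult_right_mono) (auto simp: divide_simps)
    finally show ?thesis by simp
  qed
  have "scaled_poly N (Suc k) t \<le> (\<Sum>l=Suc k..N. real (l choose k) / real (N choose k) * inverse t ^ (N - l))"
    unfolding scaled_poly_def using assms by (intro sum_mono mult_right_mono coeff) auto
  also have "\<dots> \<le> scaled_poly N k t"
    unfolding scaled_poly_def using assms by (intro sum_mono2) auto
  finally show ?thesis .
qed

text \<open>Justifies the description operator in \<open>t_fun\<close>: the polynomial changes sign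
  between 0 and 1, and strict monotonicity of \<open>scaled_poly\<close> excludes a second positive
  root.\<close>

lemma t_fun_root:
  assumes "k < N" "0 < \<beta>" "\<beta> < 1"
  shows "0 < t_fun N \<beta> k" "t_fun N \<beta> k < 1" "\<beta> / (real N + 1) * scaled_poly N k (t_fun N \<beta> k) = 1"
proof -
  define g where "g t = \<beta> / (real N + 1) * (\<Sum>l=k..N. real (l choose k) * t ^ (l - k))
      - real (N choose k) * t ^ (N - k)" for t :: real
  have g_iff: "g t = 0 \<longleftrightarrow> \<beta> / (real N + 1) * scaled_poly N k t = 1" if "0 < t" for t
  proof -
    have "g t = real (N choose k) * t ^ (N - k) * (\<beta> / (real N + 1) * scaled_poly N k t - 1)"
      unfolding g_def using scaled_poly_eq[of k N t] assms that by (simp add: algebra_simps)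
    then show ?thesis using that assms by simp
  qed
  \<comment> \<open>At 0 only \<open>l = k\<close> survives, through \<open>0 ^ 0 = 1\<close>, while
    the subtracted power vanishes because \<open>k < N\<close>.\<close>
  have "(\<Sum>l=k..N. real (l choose k) * 0 ^ (l - k)) = (\<Sum>l\<in>{k}. real (l choose k) * 0 ^ (l - k))"
    using assms by (intro sum.mono_neutral_right) (auto simp: power_0_left)
  then have g0: "0 < g 0" using assms by (simp add: g_def zero_power del: power_0_left)
  \<comment> \<open>At 1 the hockey-stick identity and absorption give the closed form
    \<open>(\<beta> / (k + 1) - 1) * (N choose k)\<close>, which is negative.\<close>
  have "(\<Sum>l=k..N. real (l choose k)) = (\<Sum>l\<le>N. real (l choose k))"
    by (intro sum.mono_neutral_left) (auto simp: binomial_eq_0)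
  also have "\<dots> = real (Suc N choose Suc k)"
    by (simp only: of_nat_sum[symmetric] sum_choose_upper)
  finally have "g 1 = \<beta> / (real N + 1) * real (Suc N choose Suc k) - real (N choose k)"
    by (simp add: g_def)
  moreover have "real (Suc k) * real (Suc N choose Suc k) = real (Suc N) * real (N choose k)"
    by (simp only: of_nat_mult[symmetric] binomial_absorption diff_Suc_1)
  then have "real (Suc N choose Suc k) = real (Suc N) * real (N choose k) / real (Suc k)"
    by (simp add: field_simps)
  ultimately have "g 1 = \<beta> / (real N + 1) * (real (Suc N) * real (N choose k) / real (Suc k)) - real (N choose k)"
    by (simp only:)
  also have "\<dots> = (\<beta> / real (Suc k) - 1) * real (N choose k)"
    by (simp add: algebra_simps add_divide_distrib[symmetric] flip: of_nat_Suc)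
  finally have "g 1 = (\<beta> / real (Suc k) - 1) * real (N choose k)" .
  moreover have "\<beta> / real (Suc k) < 1" using assms by (simp add: pos_divide_less_eq)
  ultimately have g1: "g 1 < 0" using assms by (simp add: mult_neg_pos)
  have "continuous_on {0..1} g" unfolding g_def by (intro continuous_intros)
  with g0 g1 obtain t where t: "0 \<le> t" "t \<le> 1" "g t = 0"
    using IVT2'[of g 1 0 0] by auto
  moreover from t g0 g1 have "t \<noteq> 0" "t \<noteq> 1" by auto
  ultimately have t01: "0 < t" "t < 1" by auto
  have uniq: "s = t" if "0 < s" "g s = 0" for s
  proof (rule ccontr)
    assume "s \<noteq> t"
    then have "scaled_poly N k s \<noteq> scaled_poly N k t"
      using scaled_poly_strict_antimono[of k N s t] scaled_poly_strict_antimono[of k N t s]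
        assms that t01 by (cases "s < t") auto
    then show False using g_iff[of s] g_iff[of t] that t t01 assms by (auto simp: field_simps)
  qed
  have "t_fun N \<beta> k = (THE t. 0 < t \<and> t < 1 \<and> g t = 0)"
    using assms by (simp add: t_fun_def g_def)
  also have "\<dots> = t" using t(3) t01 by (intro the_equality) (blast intro: uniq)+
  finally have "t_fun N \<beta> k = t" .
  then show "0 < t_fun N \<beta> k" "t_fun N \<beta> k < 1"
    "\<beta> / (real N + 1) * scaled_poly N k (t_fun N \<beta> k) = 1"
    using t t01 g_iff[OF t01(1)] by (simp_all only:)
qed

text \<open>If the root for \<open>Suc k\<close> exceeded that for \<open>k\<close>, the decrease of
  \<open>scaled_poly\<close> in both arguments would separate its values at the two roots, yet both
  equal \<open>(N + 1) / \<beta>\<close>. For \<open>Suc k \<ge> N\<close> the value is 0.\<close>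

lemma t_fun_antimono:
  assumes "0 < \<beta>" "\<beta> < 1" "k \<le> n"
  shows "t_fun N \<beta> n \<le> t_fun N \<beta> k"
proof (rule lift_Suc_antimono_le[OF _ \<open>k \<le> n\<close>])
  fix k
  show "t_fun N \<beta> (Suc k) \<le> t_fun N \<beta> k"
  proof (cases "Suc k < N")
    case False
    then have "t_fun N \<beta> (Suc k) = 0" by (simp add: t_fun_def)
    moreover have "0 \<le> t_fun N \<beta> k"
      using t_fun_root(1)[of k N \<beta>] assms by (cases "k < N") (auto simp: t_fun_def)
    ultimately show ?thesis by simp
  next
    case True
    let ?s = "t_fun N \<beta> (Suc k)" and ?t = "t_fun N \<beta> k"
    show ?thesis
    proof (rule ccontr)
      assume "\<not> ?s \<le> ?t"
      then have "scaled_poly N k ?s < scaled_poly N k ?t"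
        using True assms t_fun_root(1)[of k N \<beta>] by (intro scaled_poly_strict_antimono) auto
      moreover have "scaled_poly N (Suc k) ?s \<le> scaled_poly N k ?s"
        using True assms t_fun_root(1)[of "Suc k" N \<beta>] by (intro scaled_poly_Suc_le) auto
      ultimately have "\<beta> / (real N + 1) * scaled_poly N (Suc k) ?s < \<beta> / (real N + 1) * scaled_poly N k ?t"
        using assms by (intro mult_strict_left_mono) auto
      then show False
        using t_fun_root(3)[of k N \<beta>] t_fun_root(3)[of "Suc k" N \<beta>] True assms by simp
    qed
  qed
qed

text \<open>To the left of the root, \<open>scaled_poly\<close> is at least
  \<open>(N + 1) / \<beta>\<close>; multiplying by \<open>u ^ (N - k)\<close> returns to polynomial
  form. The point \<open>u = 0\<close> is separate because \<open>scaled_poly\<close> inverts its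
  argument.\<close>

lemma power_below_t_fun:
  assumes "0 < \<beta>" "\<beta> < 1" "k \<le> N" "0 \<le> u" "u < t_fun N \<beta> k"
  shows "u ^ (N - k) \<le> \<beta> / (real N + 1) * (\<Sum>l=k..N. real (l choose k) / real (N choose k) * u ^ (l - k))"
proof (cases "u = 0")
  case True
  \<comment> \<open>For \<open>k \<ge> N\<close> the value of \<open>t_fun\<close> is 0, leaving no
    room for \<open>0 \<le> u < t_fun N \<beta> k\<close>.\<close>
  have "k < N" using assms by (cases "k < N") (auto simp: t_fun_def)
  then show ?thesis using True assms by (auto intro!: mult_nonneg_nonneg divide_nonneg_nonneg sum_nonneg simp: power_0_left)
next
  case False
  have kN: "k < N" using assms by (cases "k < N") (auto simp: t_fun_def)
  have "1 = \<beta> / (real N + 1) * scaled_poly N k (t_fun N \<beta> k)"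
    using t_fun_root(3)[of k N \<beta>] kN assms by linarith
  also have "\<dots> \<le> \<beta> / (real N + 1) * scaled_poly N k u"
    using scaled_poly_strict_antimono[of k N u "t_fun N \<beta> k"] kN False assms
    by (intro mult_left_mono) auto
  finally have "u ^ (N - k) * 1 \<le> u ^ (N - k) * (\<beta> / (real N + 1) * scaled_poly N k u)"
    using assms by (intro mult_left_mono) auto
  also have "\<dots> = \<beta> / (real N + 1) * ((\<Sum>l=k..N. real (l choose k) * u ^ (l - k)) / real (N choose k))"
    using scaled_poly_eq[of k N u] kN False assms by (simp add: field_simps)
  finally show ?thesis by (simp add: sum_divide_distrib)
qed

text \<open>Supersets are grouped by size \<open>l\<close>: there are
  \<open>(N - k) choose (l - k)\<close> of them, and dividing by \<open>N choose l\<close> gives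
  \<open>(l choose k) / (N choose k)\<close>. This turns weights on sets into the coefficients of
  the polynomial.\<close>

lemma sum_supersets:
  fixes u :: real
  assumes "finite I" "J \<subseteq> I"
  shows "(\<Sum>K | J \<subseteq> K \<and> K \<subseteq> I. u ^ (card K - card J) / real (card I choose card K))
    = (\<Sum>l=card J..card I. real (l choose card J) / real (card I choose card J) * u ^ (l - card J))"
proof -
  let ?N = "card I" and ?k = "card J"
  let ?S = "{K. J \<subseteq> K \<and> K \<subseteq> I}"
  have fin: "finite J" "finite ?S" using assms finite_subset[of ?S "Pow I"] by (auto intro: finite_subset)
  have kN: "?k \<le> ?N" using assms by (simp add: card_mono)
  have card_S: "card {K \<in> ?S. card K = l} = (?N - ?k) choose (l - ?k)" if l: "l \<in> {?k..?N}" for l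
  proof -
    have "bij_betw (\<lambda>K. K - J) {K \<in> ?S. card K = l} {L. L \<subseteq> I - J \<and> card L = l - ?k}"
    proof (rule bij_betw_byWitness[where f' = "\<lambda>L. L \<union> J"])
      show "(\<lambda>K. K - J) ` {K \<in> ?S. card K = l} \<subseteq> {L. L \<subseteq> I - J \<and> card L = l - ?k}"
        using fin by (auto simp: card_Diff_subset)
      show "(\<lambda>L. L \<union> J) ` {L. L \<subseteq> I - J \<and> card L = l - ?k} \<subseteq> {K \<in> ?S. card K = l}"
      proof safe
        fix L assume "L \<subseteq> I - J" "card L = l - ?k"
        moreover from this have "finite L" using assms by (meson finite_Diff finite_subset)
        ultimately show "card (L \<union> J) = l" using fin l by (subst card_Un_disjoint) auto
      qed (use assms in auto)
    qed (use assms in auto)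
    then have "card {K \<in> ?S. card K = l} = card {L. L \<subseteq> I - J \<and> card L = l - ?k}"
      by (rule bij_betw_same_card)
    also have "\<dots> = card (I - J) choose (l - ?k)" using assms by (intro n_subsets) auto
    finally show ?thesis using assms fin by (simp add: card_Diff_subset)
  qed
  have ratio: "real ((?N - ?k) choose (l - ?k)) / real (?N choose l) = real (l choose ?k) / real (?N choose ?k)"
    if l: "l \<in> {?k..?N}" for l
  proof -
    have "real (?N choose l) * real (l choose ?k) = real (?N choose ?k) * real ((?N - ?k) choose (l - ?k))"
      unfolding of_nat_mult[symmetric] using l by (subst choose_mult) auto
    then show ?thesis using l kN by (simp add: field_simps)
  qed
  have "(\<Sum>K\<in>?S. u ^ (card K - ?k) / real (?N choose card K))
      = (\<Sum>l\<in>{?k..?N}. \<Sum>K\<in>{K \<in> ?S. card K = l}. u ^ (card K - ?k) / real (?N choose card K))"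
    using assms fin by (intro sum.group[symmetric]) (auto intro!: card_mono elim: finite_subset)
  also have "\<dots> = (\<Sum>l\<in>{?k..?N}. real ((?N - ?k) choose (l - ?k)) * (u ^ (l - ?k) / real (?N choose l)))"
    using card_S by (intro sum.cong refl) simp
  also have "\<dots> = (\<Sum>l=?k..?N. real (l choose ?k) / real (?N choose ?k) * u ^ (l - ?k))"
    using ratio by (intro sum.cong refl) (simp add: field_simps)
  finally show ?thesis .
qed

subsection \<open>Solutions and support constraints\<close>

text \<open>Only the set of sampled scenarios matters, not their indices or multiplicities.\<close>

lemma qvi_solution_image_cong:
  assumes "\<delta> ` I = \<delta>' ` I'"
  shows "qvi_solution F X I \<delta> = qvi_solution F X I' \<delta>'"
proof -
  have "qvi_feasible X I \<delta> x = (\<Inter>d\<in>\<delta> ` I. X d x)" for I \<delta> x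
    by (simp add: qvi_feasible_def)
  then have "qvi_feasible X I \<delta> x = qvi_feasible X I' \<delta>' x" for x by (simp only: assms)
  then show ?thesis by (simp add: qvi_solution_def fun_eq_iff)
qed

lemma qvi_solution_cong:
  assumes "\<And>i. i \<in> I \<Longrightarrow> \<delta> i = \<delta>' i"
  shows "qvi_solution F X I \<delta> = qvi_solution F X I \<delta>'"
  using assms by (intro qvi_solution_image_cong) auto

lemma qvi_sol_cong:
  assumes "\<And>i. i \<in> I \<Longrightarrow> \<delta> i = \<delta>' i"
  shows "qvi_sol F X I \<delta> = qvi_sol F X I \<delta>'"
  unfolding qvi_sol_def by (rule arg_cong[OF qvi_solution_cong]) (rule assms)

lemma support_constraints_cong:
  assumes "\<And>i. i \<in> I \<Longrightarrow> \<delta> i = \<delta>' i"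
  shows "support_constraints F X I \<delta> = support_constraints F X I \<delta>'"
proof -
  have "qvi_solution F X (I - {i}) \<delta> = qvi_solution F X (I - {i}) \<delta>'" for i
    using assms by (intro qvi_solution_cong) simp
  moreover have "qvi_sol F X I \<delta> = qvi_sol F X I \<delta>'" by (rule qvi_sol_cong) (rule assms)
  ultimately show ?thesis by (simp add: support_constraints_def qvi_unique_solution_def)
qed

lemma support_constraints_subset: "support_constraints F X I \<delta> \<subseteq> I"
  by (auto simp: support_constraints_def)

lemma qvi_unique_solution_iff:
  "qvi_unique_solution F X I \<delta> y \<longleftrightarrow> (\<exists>!x. qvi_solution F X I \<delta> x) \<and> y = qvi_sol F X I \<delta>"
  unfolding qvi_unique_solution_def qvi_sol_def by (metis theI')

lemma qvi_feasible_mono: "J \<subseteq> K \<Longrightarrow> qvi_feasible X K \<delta> x \<subseteq> qvi_feasible X J \<delta> x"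
  by (auto simp: qvi_feasible_def)

text \<open>Constraints satisfied at \<open>x\<close> keep \<open>x\<close> feasible, and they only
  shrink the set of points at which the inequality is tested.\<close>

lemma qvi_solution_superset:
  assumes "qvi_solution F X J \<delta> x" "J \<subseteq> K" "\<And>i. i \<in> K - J \<Longrightarrow> x \<in> X (\<delta> i) x"
  shows "qvi_solution F X K \<delta> x"
  using assms qvi_feasible_mono[OF assms(2), of X \<delta> x]
  by (auto simp: qvi_solution_def qvi_feasible_def)

locale qvi_scenario = prob_space P
  for P :: "'d measure" and N :: nat and F :: "real ^ 'n \<Rightarrow> real ^ 'n"
    and X :: "'d \<Rightarrow> real ^ 'n \<Rightarrow> (real ^ 'n) set" +
  assumes solution_exists1: "\<And>\<delta>. \<delta> \<in> {..<N} \<rightarrow> space P \<Longrightarrow> \<exists>!x. qvi_solution F X {..<N} \<delta> x"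
    and sets_constraint: "{z \<in> space (borel \<Otimes>\<^sub>M P). fst z \<in> X (snd z) (fst z)} \<in> sets (borel \<Otimes>\<^sub>M P)"
    and measurable_sol_all: "(\<lambda>\<delta>. qvi_sol F X {..<N} \<delta>) \<in> borel_measurable (\<Pi>\<^sub>M i\<in>{..<N}. P)"
begin

abbreviation samples :: "(nat \<Rightarrow> 'd) measure" where
  "samples \<equiv> \<Pi>\<^sub>M i\<in>{..<N}. P"

abbreviation sol :: "nat set \<Rightarrow> (nat \<Rightarrow> 'd) \<Rightarrow> real ^ 'n" where
  "sol \<equiv> qvi_sol F X"

abbreviation support :: "nat set \<Rightarrow> (nat \<Rightarrow> 'd) \<Rightarrow> nat set" where
  "support \<equiv> support_constraints F X"

text \<open>Free of the samples: the unconstrained problem involves \<open>F\<close> alone, and a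
  nonempty set of constraints always has a unique solution.\<close>

definition solvable :: "nat set \<Rightarrow> bool" where
  "solvable J \<longleftrightarrow> J \<noteq> {} \<or> (\<exists>!x. \<forall>y. 0 \<le> F x \<bullet> (y - x))"

text \<open>Filling up the samples outside \<open>J\<close> with copies of one inside \<open>J\<close> turns the problem
  with constraints \<open>J\<close> into one with all \<open>N\<close> constraints.\<close>

definition fill :: "nat set \<Rightarrow> (nat \<Rightarrow> 'd) \<Rightarrow> nat \<Rightarrow> 'd" where
  "fill J \<delta> = (\<lambda>i\<in>{..<N}. \<delta> (if i \<in> J then i else Min J))"

lemma solution_fill:
  assumes "J \<noteq> {}" "J \<subseteq> {..<N}"
  shows "qvi_solution F X {..<N} (fill J \<delta>) = qvi_solution F X J \<delta>"
proof (rule qvi_solution_image_cong)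
  have "Min J \<in> J" using assms by (intro Min_in) (auto intro: finite_subset)
  then show "fill J \<delta> ` {..<N} = \<delta> ` J"
    using assms by (auto simp: fill_def image_iff)
qed

lemma space_samples: "\<delta> \<in> space samples \<Longrightarrow> i < N \<Longrightarrow> \<delta> i \<in> space P"
  by (auto simp: space_PiM)

lemma fill_measurable:
  assumes "J \<noteq> {}" "J \<subseteq> {..<N}"
  shows "fill J \<in> measurable samples samples"
proof -
  have "Min J \<in> J" using assms by (intro Min_in) (auto intro: finite_subset)
  then show ?thesis
    unfolding fill_def using assms by (intro measurable_restrict measurable_component_singleton) auto
qed

text \<open>For nonempty \<open>J\<close> the filled tuple is again a tuple of \<open>N\<close>
  samples, so the existence assumption applies. Unique solvability thereby reduces to equations
  between the measurable maps \<open>sol\<close>.\<close>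

lemma unique_solution_iff:
  assumes "J \<subseteq> {..<N}" "\<delta> \<in> space samples"
  shows "qvi_unique_solution F X J \<delta> y \<longleftrightarrow> solvable J \<and> y = sol J \<delta>"
proof (cases "J = {}")
  case True
  then show ?thesis
    by (simp add: qvi_unique_solution_iff solvable_def qvi_solution_def qvi_feasible_def)
next
  case False
  have "fill J \<delta> \<in> space samples"
    using measurable_space[OF fill_measurable] False assms by blast
  then have "\<exists>!x. qvi_solution F X {..<N} (fill J \<delta>) x"
    by (intro solution_exists1) (auto simp: space_PiM)
  then show ?thesis
    using False assms by (simp add: qvi_unique_solution_iff solvable_def solution_fill)
qed

section \<open>Measurability of solutions, support sets and the risk\<close>

text \<open>For nonempty \<open>J\<close> this is the full solution map composed with the measurable
  \<open>fill J\<close>; for empty \<open>J\<close> the map is constant.\<close>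

lemma measurable_sol [measurable]:
  assumes "J \<subseteq> {..<N}"
  shows "sol J \<in> borel_measurable samples"
proof (cases "J = {}")
  case True
  have "sol {} \<delta> = sol {} \<delta>'" for \<delta> \<delta>' by (rule qvi_sol_cong) simp
  then have "sol J = (\<lambda>_. sol {} undefined)" using True by auto
  then show ?thesis by simp
next
  case False
  have "sol J = (\<lambda>\<delta>. sol {..<N} (fill J \<delta>))"
    using False assms by (intro ext) (simp add: qvi_sol_def solution_fill)
  then show ?thesis
    using measurable_compose[OF fill_measurable measurable_sol_all] False assms by simp
qed

lemma in_support_iff:
  assumes "K \<subseteq> {..<N}" "\<delta> \<in> space samples"
  shows "i \<in> support K \<delta> \<longleftrightarrow> i \<in> K \<and> \<not> (solvable (K - {i}) \<and> sol K \<delta> = sol (K - {i}) \<delta>)"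
  using assms unique_solution_iff[of "K - {i}" \<delta>] by (auto simp: support_constraints_def)

lemma pred_in_support [measurable]:
  assumes [simp]: "K \<subseteq> {..<N}"
  shows "Measurable.pred samples (\<lambda>\<delta>. i \<in> support K \<delta>)"
proof -
  have [simp]: "K - {i} \<subseteq> {..<N}" using assms by blast
  \<comment> \<open>Equality is tested by comparing the Borel measurable difference with 0.\<close>
  have "Measurable.pred samples (\<lambda>\<delta>. sol K \<delta> = sol (K - {i}) \<delta>)"
    using borel_measurable_diff[OF measurable_sol[of K] measurable_sol[of "K - {i}"]]
    by (subst eq_iff_diff_eq_0) measurable
  then have "Measurable.pred samples (\<lambda>\<delta>. i \<in> K \<and> \<not> (solvable (K - {i}) \<and> sol K \<delta> = sol (K - {i}) \<delta>))"
    by measurable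
  then show ?thesis
    by (rule measurable_cong[THEN iffD1, rotated]) (simp add: in_support_iff)
qed

lemma pred_support_eq [measurable]:
  assumes [simp]: "K \<subseteq> {..<N}"
  shows "Measurable.pred samples (\<lambda>\<delta>. support K \<delta> = S)"
proof (cases "S \<subseteq> {..<N}")
  case True
  then have "support K \<delta> = S \<longleftrightarrow> (\<forall>i\<in>{..<N}. i \<in> support K \<delta> \<longleftrightarrow> i \<in> S)" for \<delta>
    using assms support_constraints_subset[of F X K \<delta>] by blast
  then show ?thesis by simp
next
  case False
  then have "support K \<delta> \<noteq> S" for \<delta>
    using assms support_constraints_subset[of F X K \<delta>] by blast
  then show ?thesis by simp
qed

lemma pred_satisfied [measurable]:
  assumes [measurable]: "x \<in> borel_measurable samples" and "i \<in> {..<N}"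
  shows "Measurable.pred samples (\<lambda>\<delta>. x \<delta> \<in> X (\<delta> i) (x \<delta>))"
proof -
  have "(\<lambda>\<delta>. (x \<delta>, \<delta> i)) \<in> measurable samples (borel \<Otimes>\<^sub>M P)"
    using assms by (intro measurable_Pair measurable_component_singleton) auto
  from measurable_sets[OF this sets_constraint]
  have "(\<lambda>\<delta>. (x \<delta>, \<delta> i)) -` {z \<in> space (borel \<Otimes>\<^sub>M P). fst z \<in> X (snd z) (fst z)} \<inter> space samples \<in> sets samples" .
  also have "(\<lambda>\<delta>. (x \<delta>, \<delta> i)) -` {z \<in> space (borel \<Otimes>\<^sub>M P). fst z \<in> X (snd z) (fst z)} \<inter> space samples
      = {\<delta> \<in> space samples. x \<delta> \<in> X (\<delta> i) (x \<delta>)}"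
    using assms by (auto simp: space_pair_measure space_samples)
  finally show ?thesis by (simp add: pred_def)
qed

lemma sets_satisfied: "{d \<in> space P. x \<in> X d x} \<in> events"
proof -
  have "Pair x -` {z \<in> space (borel \<Otimes>\<^sub>M P). fst z \<in> X (snd z) (fst z)} \<in> events"
    using sets_constraint by (rule sets_Pair1)
  then show ?thesis by (simp add: space_pair_measure vimage_def)
qed

lemma risk_eq: "1 - risk P X x = prob {d \<in> space P. x \<in> X d x}"
proof -
  have "{d \<in> space P. x \<notin> X d x} = space P - {d \<in> space P. x \<in> X d x}" by blast
  then show ?thesis unfolding risk_def by (simp add: prob_compl[OF sets_satisfied])
qed

lemma risk_bounds: "0 \<le> risk P X x" "risk P X x \<le> 1"
  unfolding risk_def by simp_all

lemma measurable_risk [measurable]: "risk P X \<in> borel_measurable borel"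
proof -
  let ?A = "{z \<in> space (borel \<Otimes>\<^sub>M P). fst z \<in> X (snd z) (fst z)}"
  have "(\<lambda>x. emeasure P (Pair x -` ?A)) \<in> borel_measurable borel"
    using sets_constraint by (rule measurable_emeasure_Pair)
  then have "(\<lambda>x. 1 - measure P (Pair x -` ?A)) \<in> borel_measurable borel"
    unfolding measure_def by measurable
  also have "(\<lambda>x. 1 - measure P (Pair x -` ?A)) = risk P X"
    using risk_eq by (auto simp: fun_eq_iff space_pair_measure vimage_def algebra_simps)
  finally show ?thesis .
qed

lemma prob_space_samples: "prob_space samples"
  by (intro prob_space_PiM) unfold_locales

section \<open>Irredundant and generating sets of constraints\<close>

definition irredundant :: "nat set \<Rightarrow> (nat \<Rightarrow> 'd) \<Rightarrow> bool" where
  "irredundant J \<delta> \<longleftrightarrow> solvable J \<and> support J \<delta> = J"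

definition generates :: "nat set \<Rightarrow> nat set \<Rightarrow> (nat \<Rightarrow> 'd) \<Rightarrow> bool" where
  "generates J K \<delta> \<longleftrightarrow> irredundant J \<delta> \<and> (\<forall>i\<in>K - J. sol J \<delta> \<in> X (\<delta> i) (sol J \<delta>))"

definition nondegenerate :: "(nat \<Rightarrow> 'd) \<Rightarrow> bool" where
  "nondegenerate \<delta> \<longleftrightarrow> qvi_unique_solution F X (support {..<N} \<delta>) \<delta> (sol {..<N} \<delta>)"

lemma pred_irredundant [measurable]:
  assumes [simp]: "J \<subseteq> {..<N}"
  shows "Measurable.pred samples (irredundant J)"
  unfolding irredundant_def by measurable

lemma pred_generates [measurable]:
  assumes [simp]: "J \<subseteq> {..<N}" and K: "K \<subseteq> {..<N}"
  shows "Measurable.pred samples (generates J K)"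
proof -
  have "finite (K - J)" using K by (auto intro: finite_subset)
  moreover have "i \<in> {..<N}" if "i \<in> K - J" for i using that K by blast
  ultimately have "Measurable.pred samples (\<lambda>\<delta>. \<forall>i\<in>K - J. sol J \<delta> \<in> X (\<delta> i) (sol J \<delta>))"
    by (intro pred_intros_finite pred_satisfied measurable_sol) auto
  then show ?thesis unfolding generates_def by measurable
qed

text \<open>Dependence on the samples in \<open>J\<close> alone is what later allows the other
  samples to be integrated out.\<close>

lemma irredundant_cong:
  assumes "\<And>i. i \<in> J \<Longrightarrow> \<delta> i = \<delta>' i"
  shows "irredundant J \<delta> = irredundant J \<delta>'"
proof -
  have "support J \<delta> = support J \<delta>'" by (rule support_constraints_cong) (rule assms)
  then show ?thesis by (simp add: irredundant_def)
qed

text \<open>The solution for \<open>J\<close> still solves the problem for \<open>K\<close>, and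
  uniqueness there identifies it. If \<open>K\<close> is empty, so is \<open>J\<close>, which
  settles solvability.\<close>

lemma sol_superset:
  assumes "solvable J" "J \<subseteq> K" "K \<subseteq> {..<N}" "\<delta> \<in> space samples"
    and "\<And>i. i \<in> K - J \<Longrightarrow> sol J \<delta> \<in> X (\<delta> i) (sol J \<delta>)"
  shows "solvable K" "sol K \<delta> = sol J \<delta>"
proof -
  show K: "solvable K" using assms by (auto simp: solvable_def)
  have "qvi_unique_solution F X J \<delta> (sol J \<delta>)" using unique_solution_iff[of J \<delta>] assms by auto
  then have "qvi_solution F X K \<delta> (sol J \<delta>)"
    unfolding qvi_unique_solution_def
    using qvi_solution_superset[of F X J \<delta> "sol J \<delta>" K] assms(2,5) by simp
  moreover have "qvi_unique_solution F X K \<delta> (sol K \<delta>)" using unique_solution_iff[of K \<delta>] assms K by auto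
  ultimately show "sol K \<delta> = sol J \<delta>" by (auto simp: qvi_unique_solution_def)
qed

lemma sol_satisfied:
  assumes "K \<subseteq> {..<N}" "\<delta> \<in> space samples" "i \<in> K"
  shows "sol K \<delta> \<in> X (\<delta> i) (sol K \<delta>)"
proof -
  have "qvi_unique_solution F X K \<delta> (sol K \<delta>)"
    using unique_solution_iff[of K \<delta>] assms by (auto simp: solvable_def)
  then show ?thesis using assms by (auto simp: qvi_unique_solution_def qvi_solution_def qvi_feasible_def)
qed

lemma generates_sol:
  assumes "generates J K \<delta>" "J \<subseteq> K" "K \<subseteq> {..<N}" "\<delta> \<in> space samples"
  shows "sol K \<delta> = sol J \<delta>"
  using assms by (intro sol_superset(2)) (auto simp: generates_def irredundant_def)

text \<open>Dropping some \<open>i\<close> in \<open>K - J\<close> leaves a set that still contains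
  \<open>J\<close>, so its solution is again that of \<open>J\<close>.\<close>

lemma support_subset_generates:
  assumes "generates J K \<delta>" "J \<subseteq> K" "K \<subseteq> {..<N}" "\<delta> \<in> space samples"
  shows "support K \<delta> \<subseteq> J"
proof
  fix i assume i: "i \<in> support K \<delta>"
  show "i \<in> J"
  proof (rule ccontr)
    assume "i \<notin> J"
    then have "solvable (K - {i})" "sol (K - {i}) \<delta> = sol J \<delta>"
      using assms sol_superset[of J "K - {i}" \<delta>] by (auto simp: generates_def irredundant_def)
    moreover have "sol K \<delta> = sol J \<delta>" using assms by (rule generates_sol)
    ultimately show False using i in_support_iff[of K \<delta> i] assms by auto
  qed
qed

text \<open>Non-degeneracy gives the support set \<open>?S\<close> the same solution as
  \<open>J\<close>. An \<open>i\<close> in \<open>J\<close> outside \<open>?S\<close> could then be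
  dropped from \<open>J\<close> without effect, as \<open>J - {i}\<close> still contains
  \<open>?S\<close>; this contradicts irredundance.\<close>

lemma generates_unique:
  assumes "nondegenerate \<delta>" "generates J {..<N} \<delta>" "J \<subseteq> {..<N}" "\<delta> \<in> space samples"
  shows "J = support {..<N} \<delta>"
proof (rule antisym)
  let ?S = "support {..<N} \<delta>"
  show S_J: "?S \<subseteq> J" using assms by (intro support_subset_generates) auto
  have sol_J: "sol {..<N} \<delta> = sol J \<delta>" using assms by (intro generates_sol) auto
  have S: "solvable ?S" "sol ?S \<delta> = sol J \<delta>"
    using assms sol_J unique_solution_iff[OF support_constraints_subset[of F X "{..<N}" \<delta>] assms(4)]
    by (auto simp: nondegenerate_def)
  show "J \<subseteq> ?S"
  proof
    fix i assume i: "i \<in> J"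
    show "i \<in> ?S"
    proof (rule ccontr)
      assume "i \<notin> ?S"
      then have "solvable (J - {i})" "sol (J - {i}) \<delta> = sol ?S \<delta>"
        using S S_J assms sol_satisfied[of J \<delta>] sol_superset[of ?S "J - {i}" \<delta>] by auto
      moreover have "i \<in> support J \<delta>"
        using assms i by (auto simp: generates_def irredundant_def)
      ultimately show False using S in_support_iff[of J \<delta> i] assms by auto
    qed
  qed
qed

text \<open>If \<open>i\<close> were not of support within the support set, the remaining support
  constraints would already determine the full solution, which satisfies all other constraints; so
  \<open>i\<close> could be dropped from the full problem too.\<close>

lemma support_generates:
  assumes "nondegenerate \<delta>" "\<delta> \<in> space samples"
  shows "generates (support {..<N} \<delta>) {..<N} \<delta>" "sol (support {..<N} \<delta>) \<delta> = sol {..<N} \<delta>"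
proof -
  let ?S = "support {..<N} \<delta>"
  have S_N: "?S \<subseteq> {..<N}" by (rule support_constraints_subset)
  have S: "solvable ?S" "sol ?S \<delta> = sol {..<N} \<delta>"
    using assms unique_solution_iff[OF S_N] by (auto simp: nondegenerate_def)
  show "sol ?S \<delta> = sol {..<N} \<delta>" by (rule S)
  have "i \<in> support ?S \<delta>" if i: "i \<in> ?S" for i
  proof (rule ccontr)
    assume "i \<notin> support ?S \<delta>"
    then have "solvable (?S - {i})" "sol ?S \<delta> = sol (?S - {i}) \<delta>"
      using i in_support_iff[OF S_N assms(2), of i] by auto
    then have "solvable ({..<N} - {i})" "sol ({..<N} - {i}) \<delta> = sol {..<N} \<delta>"
      using S S_N i assms sol_satisfied[of "{..<N}" \<delta>] sol_superset[of "?S - {i}" "{..<N} - {i}" \<delta>] by auto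
    then show False using i in_support_iff[of "{..<N}" \<delta> i] assms by auto
  qed
  then have "support ?S \<delta> = ?S" using support_constraints_subset[of F X ?S \<delta>] by blast
  then show "generates ?S {..<N} \<delta>"
    using S assms sol_satisfied[of "{..<N}" \<delta>] by (auto simp: generates_def irredundant_def)
qed

subsection \<open>Probability of a large risk\<close>

text \<open>Fubini: once the samples in \<open>K\<close> are fixed, \<open>Q\<close> and
  \<open>x\<close> are constant, and each of the independent samples in \<open>R\<close> is
  satisfied with probability \<open>1 - risk P X x\<close>.\<close>

lemma emeasure_satisfied:
  assumes K: "K \<subseteq> {..<N}" and R: "R \<subseteq> {..<N} - K"
    and Q [measurable]: "Measurable.pred samples Q"
    and x [measurable]: "x \<in> borel_measurable samples"
    and dep: "\<And>\<delta> \<delta>'. (\<And>i. i \<in> K \<Longrightarrow> \<delta> i = \<delta>' i) \<Longrightarrow> Q \<delta> = Q \<delta>' \<and> x \<delta> = x \<delta>'"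
  shows "emeasure samples {\<delta> \<in> space samples. Q \<delta> \<and> (\<forall>i\<in>R. x \<delta> \<in> X (\<delta> i) (x \<delta>))}
    = (\<integral>\<^sup>+ \<delta>. ennreal (if Q \<delta> then (1 - risk P X (x \<delta>)) ^ card R else 0) \<partial>samples)"
proof -
  define L where "L = {..<N} - K"
  interpret S: product_sigma_finite "\<lambda>_::nat. P" by unfold_locales
  have fin: "finite K" "finite L" "finite R" and KL: "K \<inter> L = {}" "K \<union> L = {..<N}"
    using K R by (auto simp: L_def intro: finite_subset)
  have [measurable]: "Measurable.pred samples (\<lambda>\<delta>. \<forall>i\<in>R. x \<delta> \<in> X (\<delta> i) (x \<delta>))"
    using R fin by (intro pred_intros_finite pred_satisfied x) auto
  define A where "A = {\<delta> \<in> space samples. Q \<delta> \<and> (\<forall>i\<in>R. x \<delta> \<in> X (\<delta> i) (x \<delta>))}"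
  have A [measurable]: "A \<in> sets samples" unfolding A_def by measurable
  define g where "g \<delta> = ennreal (if Q \<delta> then (1 - risk P X (x \<delta>)) ^ card R else 0)" for \<delta>
  have g [measurable]: "g \<in> borel_measurable samples" unfolding g_def by measurable
  have fold: "integral\<^sup>N samples f = (\<integral>\<^sup>+ a. (\<integral>\<^sup>+ b. f (merge K L (a, b)) \<partial>(\<Pi>\<^sub>M i\<in>L. P)) \<partial>(\<Pi>\<^sub>M i\<in>K. P))"
    if "f \<in> borel_measurable samples" for f
    using S.product_nn_integral_fold[OF KL(1) fin(1,2), of f] that by (simp add: KL)
  interpret PL: prob_space "\<Pi>\<^sub>M i\<in>L. P" by (intro prob_space_PiM) unfold_locales
  have inner: "(\<integral>\<^sup>+ b. indicator A (merge K L (a, b)) \<partial>(\<Pi>\<^sub>M i\<in>L. P)) = (\<integral>\<^sup>+ b. g (merge K L (a, b)) \<partial>(\<Pi>\<^sub>M i\<in>L. P))"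
    if a: "a \<in> space (\<Pi>\<^sub>M i\<in>K. P)" for a
  proof -
    \<comment> \<open>\<open>a\<close> is a tuple indexed by \<open>K\<close> only; by
      \<open>dep\<close>, evaluating \<open>x\<close> at it is the same as at any extension.\<close>
    define c where "c = x a"
    define S where "S = {d \<in> space P. c \<in> X d c}"
    have S: "S \<in> events" unfolding S_def by (rule sets_satisfied)
    have m: "merge K L (a, b) \<in> space samples" if "b \<in> space (\<Pi>\<^sub>M i\<in>L. P)" for b
      using a that KL by (auto simp: space_PiM merge_def PiE_iff extensional_def)
    have ab: "Q (merge K L (a, b)) = Q a" "x (merge K L (a, b)) = c" for b
      using dep[of "merge K L (a, b)" a] by (auto simp: c_def merge_def)
    have rhs: "(\<integral>\<^sup>+ b. g (merge K L (a, b)) \<partial>(\<Pi>\<^sub>M i\<in>L. P)) = ennreal (if Q a then prob S ^ card R else 0)"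
      by (simp add: g_def ab PL.emeasure_space_1 risk_eq S_def)
    show ?thesis
    proof (cases "Q a")
      case False
      then have "indicator A (merge K L (a, b)) = (0 :: ennreal)" for b
        by (simp add: A_def ab indicator_def)
      then show ?thesis using False rhs by simp
    next
      case True
      \<comment> \<open>For fixed \<open>a\<close> the event is a box: coordinates in
        \<open>R\<close> lie in \<open>S\<close>, the rest of \<open>L\<close> is free.\<close>
      let ?B = "\<Pi>\<^sub>E i\<in>L. if i \<in> R then S else space P"
      have "indicator A (merge K L (a, b)) = (indicator ?B b :: ennreal)"
        if b: "b \<in> space (\<Pi>\<^sub>M i\<in>L. P)" for b
      proof -
        have "merge K L (a, b) i = b i" if "i \<in> L" for i
          using that KL by (auto simp: merge_def)
        then have "merge K L (a, b) \<in> A \<longleftrightarrow> b \<in> ?B"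
          using b m[OF b] True R unfolding A_def L_def[symmetric]
          by (auto simp: ab S_def space_PiM PiE_iff split: if_splits)
        then show ?thesis by (simp add: indicator_def)
      qed
      then have "(\<integral>\<^sup>+ b. indicator A (merge K L (a, b)) \<partial>(\<Pi>\<^sub>M i\<in>L. P)) = (\<integral>\<^sup>+ b. indicator ?B b \<partial>(\<Pi>\<^sub>M i\<in>L. P))"
        by (intro nn_integral_cong)
      also have "\<dots> = emeasure (\<Pi>\<^sub>M i\<in>L. P) ?B"
        using S fin by (intro nn_integral_indicator sets_PiM_I_finite) auto
      also have "\<dots> = (\<Prod>i\<in>L. emeasure P (if i \<in> R then S else space P))"
        using S fin by (intro S.emeasure_PiM) auto
      also have "\<dots> = (\<Prod>i\<in>L. if i \<in> R then ennreal (prob S) else 1)"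
        by (intro prod.cong) (auto simp: emeasure_eq_measure prob_space)
      also have "\<dots> = ennreal (prob S) ^ card R"
        using R fin by (simp add: prod.If_cases L_def Int_absorb1)
      also have "\<dots> = ennreal (prob S ^ card R)" by (simp add: ennreal_power)
      finally show ?thesis using True rhs by simp
    qed
  qed
  have "emeasure samples A = (\<integral>\<^sup>+ \<delta>. indicator A \<delta> \<partial>samples)" using A by simp
  also have "\<dots> = (\<integral>\<^sup>+ \<delta>. g \<delta> \<partial>samples)"
    unfolding fold[OF borel_measurable_indicator[OF A]] fold[OF g] by (intro nn_integral_cong inner)
  finally show ?thesis unfolding A_def g_def .
qed

lemma prob_satisfied:
  assumes "K \<subseteq> {..<N}" "R \<subseteq> {..<N} - K"
    and Q [measurable]: "Measurable.pred samples Q"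
    and x [measurable]: "x \<in> borel_measurable samples"
    and "\<And>\<delta> \<delta>'. (\<And>i. i \<in> K \<Longrightarrow> \<delta> i = \<delta>' i) \<Longrightarrow> Q \<delta> = Q \<delta>' \<and> x \<delta> = x \<delta>'"
  shows "measure samples {\<delta> \<in> space samples. Q \<delta> \<and> (\<forall>i\<in>R. x \<delta> \<in> X (\<delta> i) (x \<delta>))}
    = (\<integral>\<delta>. (if Q \<delta> then (1 - risk P X (x \<delta>)) ^ card R else 0) \<partial>samples)"
proof -
  have "enn2real (emeasure samples {\<delta> \<in> space samples. Q \<delta> \<and> (\<forall>i\<in>R. x \<delta> \<in> X (\<delta> i) (x \<delta>))})
      = enn2real (\<integral>\<^sup>+ \<delta>. ennreal (if Q \<delta> then (1 - risk P X (x \<delta>)) ^ card R else 0) \<partial>samples)"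
    by (rule arg_cong[OF emeasure_satisfied[of K R Q x]]) (fact assms)+
  also have "\<dots> = (\<integral>\<delta>. (if Q \<delta> then (1 - risk P X (x \<delta>)) ^ card R else 0) \<partial>samples)"
    by (rule integral_eq_nn_integral[symmetric]) (auto intro!: AE_I2 simp: risk_bounds)
  finally show ?thesis by (simp add: measure_def)
qed

lemma generates_cong:
  assumes "\<And>i. i \<in> K \<Longrightarrow> \<delta> i = \<delta>' i" "J \<subseteq> K"
  shows "generates J K \<delta> = generates J K \<delta>'"
proof -
  have "irredundant J \<delta> = irredundant J \<delta>'" "sol J \<delta> = sol J \<delta>'"
    using assms by (auto intro!: irredundant_cong qvi_sol_cong)
  then show ?thesis using assms by (simp add: generates_def)
qed

text \<open>If the common solution is also feasible for the samples outside \<open>K\<close>, both sets generate the full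
  problem, which non-degeneracy excludes. As the outside samples are independent of the event, the
  risk is 1 almost surely on it; but then the samples in \<open>K - J\<close> are almost surely violated.\<close>

lemma AE_not_generates_both:
  assumes nondeg: "AE \<delta> in samples. nondegenerate \<delta>"
    and J: "J \<subset> K" "J' \<subseteq> K" "K \<subseteq> {..<N}" "J \<noteq> J'"
  shows "AE \<delta> in samples. \<not> (generates J K \<delta> \<and> generates J' K \<delta>)"
proof -
  have sub [simp]: "J \<subseteq> {..<N}" "J' \<subseteq> {..<N}" "K \<subseteq> {..<N}" "J \<subseteq> K" using J by auto
  define Q where "Q \<delta> \<longleftrightarrow> generates J K \<delta> \<and> generates J' K \<delta>" for \<delta>
  have [measurable]: "Measurable.pred samples Q" unfolding Q_def by measurable
  let ?A = "{\<delta> \<in> space samples. Q \<delta> \<and> (\<forall>i\<in>{..<N} - K. sol J \<delta> \<in> X (\<delta> i) (sol J \<delta>))}"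
  have [measurable]: "Measurable.pred samples (\<lambda>\<delta>. \<forall>i\<in>{..<N} - K. sol J \<delta> \<in> X (\<delta> i) (sol J \<delta>))"
    by (intro pred_intros_finite pred_satisfied measurable_sol) auto
  have "AE \<delta> in samples. \<delta> \<notin> ?A"
    using nondeg
  proof (eventually_elim, safe)
    fix \<delta> assume \<delta>: "nondegenerate \<delta>" "\<delta> \<in> space samples" "Q \<delta>"
      "\<forall>i\<in>{..<N} - K. sol J \<delta> \<in> X (\<delta> i) (sol J \<delta>)"
    have "sol J' \<delta> = sol J \<delta>"
      using generates_sol[of J K \<delta>] generates_sol[of J' K \<delta>] \<delta> J by (simp add: Q_def)
    then have "generates J {..<N} \<delta>" "generates J' {..<N} \<delta>"
      using \<delta> by (auto simp: Q_def generates_def)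
    then show False using generates_unique[of \<delta> J] generates_unique[of \<delta> J'] \<delta> J by simp
  qed
  then have "emeasure samples ?A = 0"
    by (subst (asm) AE_iff_null_sets[symmetric]) (auto simp: null_sets_def)
  moreover have "emeasure samples ?A
      = (\<integral>\<^sup>+ \<delta>. ennreal (if Q \<delta> then (1 - risk P X (sol J \<delta>)) ^ card ({..<N} - K) else 0) \<partial>samples)"
  proof (rule emeasure_satisfied[of K _ Q "sol J"])
    fix \<delta> \<delta>' :: "nat \<Rightarrow> 'd" assume "\<And>i. i \<in> K \<Longrightarrow> \<delta> i = \<delta>' i"
    then show "Q \<delta> = Q \<delta>' \<and> sol J \<delta> = sol J \<delta>'"
      using generates_cong[of K \<delta> \<delta>'] qvi_sol_cong[of J \<delta> \<delta>' F X] J by (auto simp: Q_def)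
  qed auto
  ultimately have "(\<integral>\<^sup>+ \<delta>. ennreal (if Q \<delta> then (1 - risk P X (sol J \<delta>)) ^ card ({..<N} - K) else 0) \<partial>samples) = 0"
    by simp
  then have "AE \<delta> in samples. ennreal (if Q \<delta> then (1 - risk P X (sol J \<delta>)) ^ card ({..<N} - K) else 0) = 0"
    by (subst (asm) nn_integral_0_iff_AE) auto
  \<comment> \<open>A vanishing power has vanishing base. If \<open>K\<close> is the full index set
    the power is 1, so \<open>Q\<close> itself fails almost surely.\<close>
  then have risk1: "AE \<delta> in samples. Q \<delta> \<longrightarrow> risk P X (sol J \<delta>) = 1"
  proof eventually_elim
    case (elim \<delta>)
    have "0 \<le> (1 - risk P X (sol J \<delta>)) ^ card ({..<N} - K)" by (simp add: risk_bounds)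
    then show ?case using elim by auto
  qed
  \<comment> \<open>Unlike \<open>Q\<close>, the bracketed condition depends on the samples in
    \<open>J\<close> only, so those in \<open>K - J\<close> can now be integrated out.\<close>
  let ?B = "{\<delta> \<in> space samples. (irredundant J \<delta> \<and> risk P X (sol J \<delta>) = 1)
    \<and> (\<forall>i\<in>K - J. sol J \<delta> \<in> X (\<delta> i) (sol J \<delta>))}"
  have "finite (K - J)" using finite_subset[OF J(3)] by simp
  have [measurable]: "Measurable.pred samples (\<lambda>\<delta>. \<forall>i\<in>K - J. sol J \<delta> \<in> X (\<delta> i) (sol J \<delta>))"
    using \<open>finite (K - J)\<close> subsetD[OF J(3)] by (intro pred_intros_finite pred_satisfied measurable_sol) auto
  \<comment> \<open>Here \<open>J\<close> must be a proper subset: the power of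
    \<open>1 - 1 = 0\<close> vanishes only for a positive exponent.\<close>
  have "K - J \<noteq> {}" using J by blast
  then have "card (K - J) \<noteq> 0" using \<open>finite (K - J)\<close> by simp
  have "emeasure samples ?B = (\<integral>\<^sup>+ \<delta>. ennreal (if irredundant J \<delta> \<and> risk P X (sol J \<delta>) = 1
      then (1 - risk P X (sol J \<delta>)) ^ card (K - J) else 0) \<partial>samples)"
  proof (rule emeasure_satisfied[of J _ "\<lambda>\<delta>. irredundant J \<delta> \<and> risk P X (sol J \<delta>) = 1" "sol J"])
    fix \<delta> \<delta>' :: "nat \<Rightarrow> 'd" assume "\<And>i. i \<in> J \<Longrightarrow> \<delta> i = \<delta>' i"
    then show "(irredundant J \<delta> \<and> risk P X (sol J \<delta>) = 1) = (irredundant J \<delta>' \<and> risk P X (sol J \<delta>') = 1)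
        \<and> sol J \<delta> = sol J \<delta>'"
      using irredundant_cong[of J \<delta> \<delta>'] qvi_sol_cong[of J \<delta> \<delta>' F X] by auto
  qed (use subsetD[OF J(3)] in auto)
  also have "\<dots> = (\<integral>\<^sup>+ \<delta>. 0 \<partial>samples)"
    using \<open>card (K - J) \<noteq> 0\<close> by (intro nn_integral_cong) auto
  finally have "?B \<in> null_sets samples" by (auto simp: null_sets_def)
  then have "AE \<delta> in samples. \<delta> \<notin> ?B" by (rule AE_not_in)
  with risk1 AE_space show ?thesis by eventually_elim (auto simp: Q_def generates_def)
qed

text \<open>The events are almost surely pairwise disjoint, so the sum is the probability of their
  union.\<close>

lemma sum_prob_generates_le:
  assumes nondeg: "AE \<delta> in samples. nondegenerate \<delta>" and K: "K \<subseteq> {..<N}"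
  shows "(\<Sum>J\<in>Pow K. measure samples {\<delta> \<in> space samples. generates J K \<delta>}) \<le> 1"
proof -
  interpret S: prob_space samples by (rule prob_space_samples)
  have fin: "finite K" using K by (auto intro: finite_subset)
  have disj: "AE \<delta> in samples. \<not> (generates J K \<delta> \<and> generates J' K \<delta>)"
    if "J \<in> Pow K" "J' \<in> Pow K" "J \<noteq> J'" for J J'
  \<comment> \<open>One of two distinct subsets of \<open>K\<close> is proper; the roles are
    exchanged if it is not \<open>J\<close>.\<close>
  proof (cases "J = K")
    case True
    then show ?thesis using AE_not_generates_both[OF nondeg, of J' K J] that K by (auto simp: conj_commute)
  next
    case False
    then show ?thesis using AE_not_generates_both[OF nondeg, of J K J'] that K by auto
  qed
  have meas: "{\<delta> \<in> space samples. generates J K \<delta>} \<in> S.events" if "J \<in> Pow K" for J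
  proof -
    have "J \<subseteq> {..<N}" using that K by auto
    then show ?thesis using K by measurable
  qed
  have "(\<Sum>J\<in>Pow K. measure samples {\<delta> \<in> space samples. generates J K \<delta>})
      = measure samples (\<Union>J\<in>Pow K. {\<delta> \<in> space samples. generates J K \<delta>})"
    using fin meas disj
    by (intro measure_UNION_AE[symmetric]) (auto simp: S.fmeasurable_eq_sets pairwise_def)
  also have "\<dots> \<le> 1" by (rule S.prob_le_1)
  finally show ?thesis .
qed

lemma prob_generates:
  assumes "J \<subseteq> K" "K \<subseteq> {..<N}"
  shows "measure samples {\<delta> \<in> space samples. generates J K \<delta>}
    = (\<integral>\<delta>. (if irredundant J \<delta> then (1 - risk P X (sol J \<delta>)) ^ (card K - card J) else 0) \<partial>samples)"
proof -
  have sub: "J \<subseteq> {..<N}" "K - J \<subseteq> {..<N} - J" using assms by auto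
  then have "finite J" by (auto intro: finite_subset)
  then have card: "card (K - J) = card K - card J" using assms by (simp add: card_Diff_subset)
  have "measure samples {\<delta> \<in> space samples. irredundant J \<delta> \<and> (\<forall>i\<in>K - J. sol J \<delta> \<in> X (\<delta> i) (sol J \<delta>))}
    = (\<integral>\<delta>. (if irredundant J \<delta> then (1 - risk P X (sol J \<delta>)) ^ card (K - J) else 0) \<partial>samples)"
    using sub by (intro prob_satisfied[of J _ "irredundant J" "sol J"] pred_irredundant measurable_sol conjI
        irredundant_cong qvi_sol_cong)
  then show ?thesis unfolding generates_def card .
qed

text \<open>With \<open>u = 1 - risk\<close>, a risk above \<open>eps_fun\<close> means
  \<open>u\<close> below \<open>t_fun\<close>. There \<open>power_below_t_fun\<close> and
  \<open>sum_supersets\<close> bound the integrand \<open>u ^ (N - card J)\<close> by a weighted sum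
  of the integrands for \<open>generates J K\<close>; elsewhere that sum is nonnegative.\<close>

lemma prob_generates_above_eps:
  assumes \<beta>: "0 < \<beta>" "\<beta> < 1" and J: "J \<subseteq> {..<N}"
  shows "measure samples {\<delta> \<in> space samples. generates J {..<N} \<delta> \<and> eps_fun N \<beta> (card J) < risk P X (sol J \<delta>)}
    \<le> (\<Sum>K | J \<subseteq> K \<and> K \<subseteq> {..<N}. \<beta> / (real N + 1) / real (N choose card K)
        * measure samples {\<delta> \<in> space samples. generates J K \<delta>})"
proof -
  let ?k = "card J" and ?S = "{K. J \<subseteq> K \<and> K \<subseteq> {..<N}}"
  let ?u = "\<lambda>\<delta>. 1 - risk P X (sol J \<delta>)"
  define c where "c K = \<beta> / (real N + 1) / real (N choose card K)" for K :: "nat set"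
  define Q where "Q \<delta> \<longleftrightarrow> irredundant J \<delta> \<and> eps_fun N \<beta> ?k < risk P X (sol J \<delta>)" for \<delta>
  interpret S: prob_space samples by (rule prob_space_samples)
  note [measurable] = pred_irredundant[OF J] measurable_sol[OF J]
  have [measurable]: "Measurable.pred samples Q" unfolding Q_def by measurable
  have kN: "?k \<le> N" using card_mono[OF _ J] by simp
  have u: "0 \<le> ?u \<delta>" "?u \<delta> \<le> 1" for \<delta> by (simp_all add: risk_bounds)
  have int: "integrable samples (\<lambda>\<delta>. if R \<delta> then ?u \<delta> ^ m else 0)"
    if [measurable]: "Measurable.pred samples R" for m R
    using u by (intro S.integrable_const_bound[of _ 1]) (auto intro!: AE_I2 simp: power_le_one)
  have card: "card ({..<N} - J) = N - ?k" using J by (simp add: card_Diff_subset finite_subset)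
  have "measure samples {\<delta> \<in> space samples. Q \<delta> \<and> (\<forall>i\<in>{..<N} - J. sol J \<delta> \<in> X (\<delta> i) (sol J \<delta>))}
      = (\<integral>\<delta>. (if Q \<delta> then ?u \<delta> ^ card ({..<N} - J) else 0) \<partial>samples)"
  proof (rule prob_satisfied[of J _ Q "sol J"])
    fix \<delta> \<delta>' :: "nat \<Rightarrow> 'd" assume "\<And>i. i \<in> J \<Longrightarrow> \<delta> i = \<delta>' i"
    then show "Q \<delta> = Q \<delta>' \<and> sol J \<delta> = sol J \<delta>'"
      using irredundant_cong[of J \<delta> \<delta>'] qvi_sol_cong[of J \<delta> \<delta>' F X] by (auto simp: Q_def)
  qed (use J in auto)
  also have "\<dots> = (\<integral>\<delta>. (if Q \<delta> then ?u \<delta> ^ (N - ?k) else 0) \<partial>samples)" by (simp only: card)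
  also have "\<dots> \<le> (\<integral>\<delta>. (\<Sum>K\<in>?S. c K * (if irredundant J \<delta> then ?u \<delta> ^ (card K - ?k) else 0)) \<partial>samples)"
  proof (rule integral_mono)
    fix \<delta>
    have nonneg: "0 \<le> (\<Sum>K\<in>?S. c K * (if irredundant J \<delta> then ?u \<delta> ^ (card K - ?k) else 0))"
      using \<beta> u by (intro sum_nonneg mult_nonneg_nonneg) (auto simp: c_def)
    show "(if Q \<delta> then ?u \<delta> ^ (N - ?k) else 0)
        \<le> (\<Sum>K\<in>?S. c K * (if irredundant J \<delta> then ?u \<delta> ^ (card K - ?k) else 0))"
    proof (cases "Q \<delta>")
      case True
      then have "?u \<delta> < t_fun N \<beta> ?k" by (simp add: Q_def eps_fun_def)
      then have "?u \<delta> ^ (N - ?k)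
          \<le> \<beta> / (real N + 1) * (\<Sum>l=?k..N. real (l choose ?k) / real (N choose ?k) * ?u \<delta> ^ (l - ?k))"
        using \<beta> kN u by (intro power_below_t_fun) auto
      also have "\<dots> = \<beta> / (real N + 1) * (\<Sum>K\<in>?S. ?u \<delta> ^ (card K - ?k) / real (N choose card K))"
        using sum_supersets[of "{..<N}" J "?u \<delta>"] J by simp
      also have "\<dots> = (\<Sum>K\<in>?S. c K * (if irredundant J \<delta> then ?u \<delta> ^ (card K - ?k) else 0))"
        using True by (simp add: Q_def c_def sum_distrib_left)
      finally show ?thesis using True by simp
    qed (use nonneg in simp)
  qed (auto intro!: int integrable_sum integrable_mult_right)
  also have "\<dots> = (\<Sum>K\<in>?S. c K * (\<integral>\<delta>. (if irredundant J \<delta> then ?u \<delta> ^ (card K - ?k) else 0) \<partial>samples))"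
    by (subst Bochner_Integration.integral_sum) (auto intro!: int integrable_mult_right)
  also have "\<dots> = (\<Sum>K\<in>?S. c K * measure samples {\<delta> \<in> space samples. generates J K \<delta>})"
    by (intro sum.cong refl) (simp add: prob_generates)
  finally show ?thesis by (simp add: Q_def c_def generates_def conj_ac)
qed

lemma pred_risk_le [measurable]:
  "Measurable.pred samples (\<lambda>\<delta>. risk P X (sol {..<N} \<delta>) \<le> c)"
  by measurable

text \<open>The support set takes finitely many values, so the random threshold is treated one value
  at a time.\<close>

lemma sets_risk_le_eps:
  "{\<delta> \<in> space samples. risk P X (sol {..<N} \<delta>) \<le> eps_fun N \<beta> (card (support {..<N} \<delta>))} \<in> sets samples"
proof -
  have "Measurable.pred samples (\<lambda>\<delta>. \<forall>S\<in>Pow {..<N}. support {..<N} \<delta> = S \<longrightarrow>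
      risk P X (sol {..<N} \<delta>) \<le> eps_fun N \<beta> (card S))"
    by (intro pred_intros_finite pred_intros_logic pred_support_eq pred_risk_le) auto
  moreover have "support {..<N} \<delta> \<in> Pow {..<N}" for \<delta>
    using support_constraints_subset by blast
  ultimately show ?thesis by (simp add: pred_def)
qed

theorem risk_le_eps:
  assumes \<beta>: "0 < \<beta>" "\<beta> < 1" and nondeg: "AE \<delta> in samples. nondegenerate \<delta>"
  shows "1 - \<beta> \<le> measure samples
    {\<delta> \<in> space samples. risk P X (sol {..<N} \<delta>) \<le> eps_fun N \<beta> (card (support {..<N} \<delta>))}"
proof -
  interpret S: prob_space samples by (rule prob_space_samples)
  let ?G = "{\<delta> \<in> space samples. risk P X (sol {..<N} \<delta>) \<le> eps_fun N \<beta> (card (support {..<N} \<delta>))}"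
  let ?B = "\<lambda>J. {\<delta> \<in> space samples. generates J {..<N} \<delta> \<and> eps_fun N \<beta> (card J) < risk P X (sol J \<delta>)}"
  let ?p = "\<lambda>J K. measure samples {\<delta> \<in> space samples. generates J K \<delta>}"
  define c where "c K = \<beta> / (real N + 1) / real (N choose card K)" for K :: "nat set"
  have B: "?B J \<in> sets samples" if J: "J \<in> Pow {..<N}" for J
  proof -
    have "J \<subseteq> {..<N}" using J by simp
    then show ?thesis by measurable
  qed
  \<comment> \<open>The witness \<open>J\<close> is the support set of the full problem, whose
    solution is the full one by non-degeneracy.\<close>
  have "AE \<delta> in samples. \<delta> \<in> space samples - ?G \<longrightarrow> \<delta> \<in> (\<Union>J\<in>Pow {..<N}. ?B J)"
    using nondeg AE_space
  proof eventually_elim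
    case (elim \<delta>)
    then show ?case
      using support_generates[of \<delta>] support_constraints_subset[of F X "{..<N}" \<delta>] by auto
  qed
  then have "measure samples (space samples - ?G) \<le> measure samples (\<Union>J\<in>Pow {..<N}. ?B J)"
    using B by (intro S.finite_measure_mono_AE) auto
  also have "\<dots> \<le> (\<Sum>J\<in>Pow {..<N}. measure samples (?B J))"
    using B by (intro S.finite_measure_subadditive_finite) auto
  also have "\<dots> \<le> (\<Sum>J\<in>Pow {..<N}. \<Sum>K | J \<subseteq> K \<and> K \<subseteq> {..<N}. c K * ?p J K)"
    unfolding c_def using \<beta> by (intro sum_mono prob_generates_above_eps) auto
  also have "\<dots> = (\<Sum>J\<in>Pow {..<N}. \<Sum>K | K \<in> Pow {..<N} \<and> J \<subseteq> K. c K * ?p J K)"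
    by (intro sum.cong) auto
  \<comment> \<open>The pairs \<open>J \<subseteq> K\<close> are regrouped by \<open>K\<close>, so
    that disjointness can bound each inner sum by 1.\<close>
  also have "\<dots> = (\<Sum>K\<in>Pow {..<N}. \<Sum>J | J \<in> Pow {..<N} \<and> J \<subseteq> K. c K * ?p J K)"
    by (rule sum.swap_restrict) auto
  also have "\<dots> = (\<Sum>K\<in>Pow {..<N}. c K * (\<Sum>J\<in>Pow K. ?p J K))"
    unfolding sum_distrib_left by (intro sum.cong) auto
  also have "\<dots> \<le> (\<Sum>K\<in>Pow {..<N}. c K * 1)"
    using \<beta> nondeg by (intro sum_mono mult_left_mono sum_prob_generates_le) (auto simp: c_def)
  also have "\<dots> = \<beta>"
  proof -
    have "(\<Sum>K\<in>Pow {..<N}. c K * 1) = \<beta> / (real N + 1) * (\<Sum>K | {} \<subseteq> K \<and> K \<subseteq> {..<N}. 1 / real (N choose card K))"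
      by (simp add: c_def sum_distrib_left Pow_def)
    \<comment> \<open>Each of the \<open>N + 1\<close> possible sizes contributes exactly 1.\<close>
    also have "(\<Sum>K | {} \<subseteq> K \<and> K \<subseteq> {..<N}. 1 / real (N choose card K)) = real N + 1"
      using sum_supersets[of "{..<N}" "{}" 1] by simp
    finally show ?thesis by simp
  qed
  finally have "measure samples (space samples - ?G) \<le> \<beta>" .
  then show ?thesis using S.prob_compl[OF sets_risk_le_eps[of \<beta>]] by simp
qed

section \<open>The convex case via Helly's theorem\<close>

text \<open>Each support constraint \<open>i\<close> has a point \<open>y i\<close> that satisfies
  all other constraints and violates the inequality. With more than \<open>n\<close> such
  constraints, Helly's theorem would merge these into one feasible point violating it.\<close>

lemma card_support_le:
  assumes \<delta>: "\<delta> \<in> space samples" and conv: "\<And>i. i < N \<Longrightarrow> convex (X (\<delta> i) (sol {..<N} \<delta>))"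
  shows "card (support {..<N} \<delta>) \<le> CARD('n)"
proof (rule ccontr)
  let ?S = "support {..<N} \<delta>"
  assume "\<not> ?thesis"
  then have large: "CARD('n) + 1 \<le> card ?S" by simp
  define x where "x = sol {..<N} \<delta>"
  define A where "A i = X (\<delta> i) x" for i
  \<comment> \<open>Bundling the open half-space with all non-support constraints adds a single
    convex set, so the family has at least \<open>n + 2\<close> members and any \<open>n + 1\<close>
    of them omit one.\<close>
  define C where "C = {y. F x \<bullet> y < F x \<bullet> x} \<inter> (\<Inter>i\<in>{..<N} - ?S. A i)"
  have S_N: "?S \<subseteq> {..<N}" by (rule support_constraints_subset)
  have finS: "finite ?S" using S_N by (rule finite_subset) simp
  have "qvi_unique_solution F X {..<N} \<delta> x"
    using unique_solution_iff[of "{..<N}" \<delta> x] \<delta> large S_N by (auto simp: solvable_def x_def)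
  then have x_A: "\<And>i. i < N \<Longrightarrow> x \<in> A i" and x_VI: "\<And>y. (\<And>i. i < N \<Longrightarrow> y \<in> A i) \<Longrightarrow> 0 \<le> F x \<bullet> (y - x)"
    by (auto simp: qvi_unique_solution_def qvi_solution_def qvi_feasible_def A_def)
  have "\<exists>y. F x \<bullet> y < F x \<bullet> x \<and> (\<forall>l\<in>{..<N} - {i}. y \<in> A l)" if i: "i \<in> ?S" for i
  proof (rule ccontr)
    assume *: "\<not> ?thesis"
    \<comment> \<open>With at least two support constraints the reduced problem is not
      unconstrained, hence uniquely solvable; \<open>i\<close> is then of support only because the
      solution changes.\<close>
    have "{..<N} - {i} \<noteq> {}"
    proof
      assume "{..<N} - {i} = {}"
      then have "?S \<subseteq> {i}" using S_N by blast
      then have "card ?S \<le> 1" using card_mono[of "{i}" ?S] by simp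
      then show False using large zero_less_card_finite[where 'a = 'n] by linarith
    qed
    moreover have "qvi_solution F X ({..<N} - {i}) \<delta> x"
      using * x_A by (auto simp: qvi_solution_def qvi_feasible_def A_def inner_diff_right not_less)
    ultimately show False
      using i unique_solution_iff[of "{..<N} - {i}" \<delta>] \<delta> in_support_iff[of "{..<N}" \<delta> i]
      by (auto simp: solvable_def x_def qvi_unique_solution_def)
  qed
  then obtain y where y: "\<And>i. i \<in> ?S \<Longrightarrow> F x \<bullet> y i < F x \<bullet> x"
    "\<And>i l. i \<in> ?S \<Longrightarrow> l < N \<Longrightarrow> l \<noteq> i \<Longrightarrow> y i \<in> A l"
    by (metis DiffI lessThan_iff singletonD)
  have y_notin: "y i \<notin> A i" if i: "i \<in> ?S" for i
  proof
    assume "y i \<in> A i"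
    then have "0 \<le> F x \<bullet> (y i - x)" using y(2)[OF i] by (intro x_VI) metis
    then show False using y(1)[OF i] by (simp add: inner_diff_right)
  qed
  \<comment> \<open>Helly's theorem counts sets, not indices, so the \<open>A i\<close> must be
    distinct from each other and from \<open>C\<close>.\<close>
  have inj: "inj_on A ?S"
  proof (rule inj_onI, rule ccontr)
    fix i l assume "i \<in> ?S" "l \<in> ?S" "A i = A l" "i \<noteq> l"
    then show False using y(2)[of i l] y_notin[of i] S_N by auto
  qed
  have C_notin: "C \<notin> A ` ?S" using x_A S_N by (auto simp: C_def)
  have "\<Inter> (insert C (A ` ?S)) \<noteq> {}"
  proof (rule Helly)
    show "DIM(real ^ 'n) + 1 \<le> card (insert C (A ` ?S))"
      using large C_notin finS by (simp add: card_image[OF inj])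
    show "\<forall>s\<in>insert C (A ` ?S). convex s"
      using conv S_N by (auto simp: C_def A_def x_def intro!: convex_Int convex_INT convex_halfspace_lt)
  next
    fix t assume t: "t \<subseteq> insert C (A ` ?S)" "card t = DIM(real ^ 'n) + 1"
    have "card t < card (insert C (A ` ?S))"
      using t large C_notin finS by (simp add: card_image[OF inj])
    then have "t \<noteq> insert C (A ` ?S)" by auto
    \<comment> \<open>If \<open>C\<close> is omitted, \<open>x\<close> is a common point; if
      \<open>A i\<close> is omitted, \<open>y i\<close> is one.\<close>
    then consider "C \<notin> t" | i where "i \<in> ?S" "A i \<notin> t" using t(1) by blast
    then show "\<Inter> t \<noteq> {}"
    proof cases
      case 1
      then have "x \<in> \<Inter> t" using t(1) x_A S_N by blast
      then show ?thesis by blast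
    next
      case 2
      have "y i \<in> s" if s: "s \<in> t" for s
      proof (cases "s = C")
        case True
        then show ?thesis using y 2 by (auto simp: C_def)
      next
        case False
        then obtain l where "l \<in> ?S" "s = A l" using s t(1) by blast
        then show ?thesis using y(2)[of i l] 2 s S_N by auto
      qed
      then show ?thesis by blast
    qed
  qed
  then obtain z where z: "z \<in> C" "\<And>i. i \<in> ?S \<Longrightarrow> z \<in> A i" by blast
  then have "0 \<le> F x \<bullet> (z - x)" by (intro x_VI) (auto simp: C_def)
  then show False using z(1) by (simp add: C_def inner_diff_right)
qed

end

theorem theorem2:
  fixes N :: nat and \<beta> :: real
    and F :: "real ^ 'n \<Rightarrow> real ^ 'n"
    and P :: "'d measure"
    and X :: "'d \<Rightarrow> real ^ 'n \<Rightarrow> (real ^ 'n) set"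
  assumes N: "N \<ge> 1"
    and \<beta>: "0 < \<beta>" "\<beta> < 1"
    and P: "prob_space P"
    and existence_uniqueness:
      "\<forall>m\<ge>1. \<forall>\<delta> \<in> {..<m} \<rightarrow> space P. \<exists>!x. qvi_solution F X {..<m} \<delta> x"
    and nondegenerate:
      "AE \<delta> in (\<Pi>\<^sub>M i\<in>{..<N}. P).
         qvi_unique_solution F X (support_constraints F X {..<N} \<delta>) \<delta> (qvi_sol F X {..<N} \<delta>)"
    and measurable_constraint:
      "{z \<in> space (borel \<Otimes>\<^sub>M P). fst z \<in> X (snd z) (fst z)} \<in> sets (borel \<Otimes>\<^sub>M P)"
    and measurable_solution:
      "(\<lambda>\<delta>. qvi_sol F X {..<N} \<delta>) \<in> borel_measurable (\<Pi>\<^sub>M i\<in>{..<N}. P)"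
  shows "measure (\<Pi>\<^sub>M i\<in>{..<N}. P)
           {\<delta> \<in> space (\<Pi>\<^sub>M i\<in>{..<N}. P).
              risk P X (qvi_sol F X {..<N} \<delta>)
                \<le> eps_fun N \<beta> (card (support_constraints F X {..<N} \<delta>))} \<ge> 1 - \<beta>
       \<and> ((\<forall>\<delta> \<in> space (\<Pi>\<^sub>M i\<in>{..<N}. P). \<forall>i<N. convex (X (\<delta> i) (qvi_sol F X {..<N} \<delta>)))
          \<longrightarrow> (\<forall>\<delta> \<in> space (\<Pi>\<^sub>M i\<in>{..<N}. P).
                  card (support_constraints F X {..<N} \<delta>) \<le> CARD('n))
              \<and> measure (\<Pi>\<^sub>M i\<in>{..<N}. P)
                  {\<delta> \<in> space (\<Pi>\<^sub>M i\<in>{..<N}. P).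
                     risk P X (qvi_sol F X {..<N} \<delta>) \<le> eps_fun N \<beta> CARD('n)} \<ge> 1 - \<beta>)"
proof -
  interpret prob_space P by (rule P)
  interpret qvi_scenario P N F X
    using existence_uniqueness N measurable_constraint measurable_solution by unfold_locales auto
  interpret S: prob_space samples by (rule prob_space_samples)
  have nondeg: "AE \<delta> in samples. nondegenerate \<delta>"
    using nondegenerate by (simp add: nondegenerate_def)
  note main = risk_le_eps[OF \<beta> nondeg]
  have "1 - \<beta> \<le> measure samples {\<delta> \<in> space samples. risk P X (sol {..<N} \<delta>) \<le> eps_fun N \<beta> CARD('n)}"
    if card: "\<forall>\<delta> \<in> space samples. card (support {..<N} \<delta>) \<le> CARD('n)"
  proof -
    \<comment> \<open>As \<open>t_fun\<close> decreases in \<open>k\<close>, \<open>eps_fun\<close>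
      increases, so the cardinality bound only relaxes the threshold.\<close>
    have "eps_fun N \<beta> (card (support {..<N} \<delta>)) \<le> eps_fun N \<beta> CARD('n)" if "\<delta> \<in> space samples" for \<delta>
      using t_fun_antimono[OF \<beta>, of "card (support {..<N} \<delta>)" "CARD('n)" N] card that
      by (simp add: eps_fun_def)
    then have "measure samples {\<delta> \<in> space samples.
          risk P X (sol {..<N} \<delta>) \<le> eps_fun N \<beta> (card (support {..<N} \<delta>))}
        \<le> measure samples {\<delta> \<in> space samples. risk P X (sol {..<N} \<delta>) \<le> eps_fun N \<beta> CARD('n)}"
      using pred_risk_le by (intro S.finite_measure_mono) (fastforce simp: pred_def)+
    then show ?thesis using main by linarith
  qed
  then show ?thesis using main card_support_le by blast
qed

end
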